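(* Let $G_1$ and $G_2$ be two finite simple graphs with disjoint vertex sets, on $n_1$ and $n_2$ vertices and with $m_1$ and $m_2$ edges, respectively. For $i=1,2$ let $\Delta_i$ and $\delta_i$ denote the maximum and minimum vertex degree of $G_i$, and let $\overline{m}_i=|E(\overline{G_i})|=\binom{n_i}{2}-m_i$. Then: (i) $\overline{SO}(G_1+G_2)\leq \sqrt{2}\,[\overline{m}_1(\Delta_1+n_2)+\overline{m}_2(\Delta_2+n_1)]$; (ii) $\overline{SO}(G_1+G_2)\geq \sqrt{2}\,[\overline{m}_1(\delta_1+n_2)+\overline{m}_2(\delta_2+n_1)]$. Moreover, equality holds (in both) if $G_1$ and $G_2$ are regular.
   Context: All graphs are finite and simple, with nonempty vertex set. The sum (join) $G_1+G_2$ of graphs with disjoint vertex sets is the graph with vertex set $V(G_1)\cup V(G_2)$ and edge set $E(G_1)\cup E(G_2)\cup\{u_1u_2: u_1\in V(G_1),\,u_2\in V(G_2)\}$. $d_G(u)$ denotes the degree of $u$ in $G$, and $\overline{G}$ is the complement of $G$. The Sombor coindex of $G$ is $$\overline{SO}(G)=\sum_{uv\in E(\overline{G})}\sqrt{d_G(u)^2+d_G(v)^2},$$ the sum being over unordered pairs of distinct non-adjacent vertices of $G$, with degrees taken in $G$. *)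

theory Defs
  imports Complex_Main
begin

record 'a graph =
  verts :: "'a set"
  edges :: "'a set set"

text \<open>The two-element subsets of a vertex set, i.e. the unordered pairs of distinct vertices.\<close>

definition vertex_pairs :: "'a set \<Rightarrow> 'a set set" where
  "vertex_pairs V = {e. e \<subseteq> V \<and> card e = 2}"

definition finite_simple_graph :: "'a graph \<Rightarrow> bool" where
  "finite_simple_graph G \<longleftrightarrow>
     finite (verts G) \<and> verts G \<noteq> {} \<and> edges G \<subseteq> vertex_pairs (verts G)"

definition vdegree :: "'a graph \<Rightarrow> 'a \<Rightarrow> nat" where
  "vdegree G u = card {e \<in> edges G. u \<in> e}"

definition max_degree :: "'a graph \<Rightarrow> nat" where
  "max_degree G = Max (vdegree G ` verts G)"

definition min_degree :: "'a graph \<Rightarrow> nat" where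
  "min_degree G = Min (vdegree G ` verts G)"

definition regular_graph :: "'a graph \<Rightarrow> bool" where
  "regular_graph G \<longleftrightarrow> (\<exists>r. \<forall>u \<in> verts G. vdegree G u = r)"

definition graph_complement :: "'a graph \<Rightarrow> 'a graph" where
  "graph_complement G =
     \<lparr>verts = verts G, edges = vertex_pairs (verts G) - edges G\<rparr>"

text \<open>Intended for graphs with disjoint vertex sets.\<close>

definition graph_join :: "'a graph \<Rightarrow> 'a graph \<Rightarrow> 'a graph" where
  "graph_join G H =
     \<lparr>verts = verts G \<union> verts H,
      edges = edges G \<union> edges H \<union> {{u, v} | u v. u \<in> verts G \<and> v \<in> verts H}\<rparr>"

text \<open>For an edge \<open>e = {u, v}\<close> of the complement, the inner sum over the endpoints of \<open>e\<close> is
  \<open>d(u)\<^sup>2 + d(v)\<^sup>2\<close>; the degrees are those in \<open>G\<close>, not in its complement.\<close>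

definition sombor_coindex :: "'a graph \<Rightarrow> real" where
  "sombor_coindex G =
     (\<Sum>e \<in> edges (graph_complement G). sqrt (\<Sum>u \<in> e. (real (vdegree G u))\<^sup>2))"

end

theory Submission
  imports Defs
begin

text \<open>
  Joining two graphs creates every edge between them, so two non-adjacent vertices of the join
  lie on the same side and are non-adjacent there: the edge set of the complement of the join is
  the disjoint union of those of the two complements (\<open>complement_edges_join\<close>). A vertex gains
  exactly one neighbour for each vertex of the other side (\<open>vdegree_join\<close>). Hence the Sombor
  coindex of the join splits into two sums, one per side, of terms
  \<open>sqrt ((d u + n)\<^sup>2 + (d v + n)\<^sup>2)\<close>, where \<open>d\<close> is the degree in that side and \<open>n\<close> the order of the
  other side (\<open>sombor_coindex_join\<close>).

  Such a term is the Euclidean norm of a vector with two entries, so it lies between \<open>sqrt 2\<close> times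
  a lower bound and \<open>sqrt 2\<close> times an upper bound of the entries. Bounding the degrees by their
  minimum and maximum gives both inequalities. For regular graphs the minimum and maximum agree,
  so the two bounds coincide and squeeze the coindex between them.
\<close>

lemma finite_vertex_pairs: "finite V \<Longrightarrow> finite (vertex_pairs V)"
  by (rule finite_subset [of _ "Pow V"]) (auto simp: vertex_pairs_def)

lemma edges_complement: "edges (graph_complement G) = vertex_pairs (verts G) - edges G"
  by (simp add: graph_complement_def)

lemma finite_complement_edges:
  "finite_simple_graph G \<Longrightarrow> finite (edges (graph_complement G))"
  by (simp add: edges_complement finite_simple_graph_def finite_vertex_pairs)

lemma card_complement_edges:
  assumes "finite_simple_graph G"
  shows "real (card (edges (graph_complement G))) =
         real (card (verts G) choose 2) - real (card (edges G))"
proof -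
  have fin: "finite (verts G)" and sub: "edges G \<subseteq> vertex_pairs (verts G)"
    using assms by (auto simp: finite_simple_graph_def)
  have "card (vertex_pairs (verts G)) = card (verts G) choose 2"
    unfolding vertex_pairs_def using fin by (rule n_subsets)
  moreover have "card (edges G) \<le> card (vertex_pairs (verts G))"
    by (intro card_mono finite_vertex_pairs fin sub)
  moreover have "card (edges (graph_complement G)) =
      card (vertex_pairs (verts G)) - card (edges G)"
    unfolding edges_complement
    by (intro card_Diff_subset finite_subset [OF sub] finite_vertex_pairs fin sub)
  ultimately show ?thesis by (simp add: of_nat_diff)
qed

section \<open>Degrees and non-edges of a join\<close>

text \<open>By this symmetry the degree formula for vertices of the first summand also serves for those
  of the second.\<close>

lemma graph_join_commute: "graph_join G H = graph_join H G"
proof -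
  have "{{u, v} |u v. u \<in> verts G \<and> v \<in> verts H} = {{u, v} |u v. u \<in> verts H \<and> v \<in> verts G}"
    by (auto simp: insert_commute)
  then show ?thesis
    by (simp add: graph_join_def Un_commute)
qed

text \<open>The new edges at \<open>u\<close> are the pairs \<open>{u, v}\<close> with \<open>v\<close> in \<open>H\<close>. They are as many as the
  vertices \<open>v\<close>, and disjointness of the vertex sets keeps them apart from the edges of \<open>G\<close>.\<close>

lemma vdegree_join:
  assumes G: "finite_simple_graph G" and H: "finite_simple_graph H"
    and disj: "verts G \<inter> verts H = {}" and u: "u \<in> verts G"
  shows "vdegree (graph_join G H) u = vdegree G u + card (verts H)"
proof -
  have subG: "e \<subseteq> verts G" if "e \<in> edges G" for e
    using G that by (auto simp: finite_simple_graph_def vertex_pairs_def)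
  have subH: "e \<subseteq> verts H" if "e \<in> edges H" for e
    using H that by (auto simp: finite_simple_graph_def vertex_pairs_def)
  have u': "u \<notin> verts H" using disj u by blast
  let ?A = "{e \<in> edges G. u \<in> e}" and ?B = "(\<lambda>v. {u, v}) ` verts H"
  have split: "{e \<in> edges (graph_join G H). u \<in> e} = ?A \<union> ?B"
    using u u' subH by (auto simp: graph_join_def)
  have finA: "finite ?A"
    using G by (intro finite_subset [OF _ finite_vertex_pairs [of "verts G"]])
      (auto simp: finite_simple_graph_def)
  have finB: "finite ?B" using H by (simp add: finite_simple_graph_def)
  have "?A \<inter> ?B = {}" using subG disj by fastforce
  then have "card (?A \<union> ?B) = card ?A + card ?B"
    using finA finB by (simp add: card_Un_disjoint)
  moreover have "card ?B = card (verts H)"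
    by (rule card_image) (auto simp: inj_on_def doubleton_eq_iff)
  ultimately show ?thesis by (simp add: vdegree_def split)
qed

text \<open>Every pair with one vertex on each side is an edge of the join, and the join adds no edge inside
  a side.\<close>

lemma complement_edges_join:
  assumes G: "finite_simple_graph G" and H: "finite_simple_graph H"
    and disj: "verts G \<inter> verts H = {}"
  shows "edges (graph_complement (graph_join G H)) =
         edges (graph_complement G) \<union> edges (graph_complement H)"
proof -
  have subG: "e \<subseteq> verts G" if "e \<in> edges G" for e
    using G that by (auto simp: finite_simple_graph_def vertex_pairs_def)
  have subH: "e \<subseteq> verts H" if "e \<in> edges H" for e
    using H that by (auto simp: finite_simple_graph_def vertex_pairs_def)
  have pair: "{a, b} \<in> edges (graph_complement (graph_join G H)) \<longleftrightarrow>
        {a, b} \<in> edges (graph_complement G) \<union> edges (graph_complement H)" (is ?P)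
    if "a \<noteq> b" for a b
  proof -
    have "{a, b} \<in> edges (graph_join G H) \<longleftrightarrow> {a, b} \<in> edges G \<or> {a, b} \<in> edges H \<or>
        a \<in> verts G \<and> b \<in> verts H \<or> b \<in> verts G \<and> a \<in> verts H"
      by (auto simp: graph_join_def doubleton_eq_iff)
    moreover have "verts (graph_join G H) = verts G \<union> verts H"
      by (simp add: graph_join_def)
    ultimately show ?P
      using that subG [of "{a, b}"] subH [of "{a, b}"] disj
      by (auto simp: edges_complement vertex_pairs_def)
  qed
  have card2: "\<exists>a b. a \<noteq> b \<and> e = {a, b}" if "e \<in> edges (graph_complement K)"
    for e and K :: "'a graph"
    using that by (auto simp: edges_complement vertex_pairs_def card_2_iff)
  show ?thesis
  proof (rule set_eqI, rule iffI)
    fix e assume e: "e \<in> edges (graph_complement (graph_join G H))"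
    with card2 pair show "e \<in> edges (graph_complement G) \<union> edges (graph_complement H)" by blast
  next
    fix e assume e: "e \<in> edges (graph_complement G) \<union> edges (graph_complement H)"
    with card2 obtain a b where "a \<noteq> b" "e = {a, b}" by blast
    with e pair show "e \<in> edges (graph_complement (graph_join G H))" by blast
  qed
qed

text \<open>Only the empty set lies in both vertex sets, and a non-edge has two elements.\<close>

lemma complement_edges_disjoint:
  fixes G H :: "'a graph"
  assumes "verts G \<inter> verts H = {}"
  shows "edges (graph_complement G) \<inter> edges (graph_complement H) = {}"
proof -
  have "e \<subseteq> {}" if "e \<subseteq> verts G" "e \<subseteq> verts H" for e
    using that assms by blast
  moreover have "e \<noteq> {}" if "card e = 2" for e :: "'a set" using that by auto
  ultimately show ?thesis by (auto simp: edges_complement vertex_pairs_def)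
qed

section \<open>The Sombor coindex of a join\<close>

text \<open>The contribution of one summand \<open>G\<close> to the coindex of a join whose other summand has
  \<open>n\<close> vertices.\<close>

definition shifted_sombor_coindex :: "'a graph \<Rightarrow> nat \<Rightarrow> real" where
  "shifted_sombor_coindex G n =
     (\<Sum>e \<in> edges (graph_complement G). sqrt (\<Sum>u \<in> e. (real (vdegree G u + n))\<^sup>2))"

lemma sombor_coindex_join:
  assumes G: "finite_simple_graph G" and H: "finite_simple_graph H"
    and disj: "verts G \<inter> verts H = {}"
  shows "sombor_coindex (graph_join G H) =
         shifted_sombor_coindex G (card (verts H)) + shifted_sombor_coindex H (card (verts G))"
proof -
  define w where "w = (\<lambda>e. sqrt (\<Sum>u \<in> e. (real (vdegree (graph_join G H) u))\<^sup>2))"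
  note dG = vdegree_join [OF assms]
  have disj': "verts H \<inter> verts G = {}" using disj by blast
  have dH: "vdegree (graph_join G H) u = vdegree H u + card (verts G)" if "u \<in> verts H" for u
    using vdegree_join [OF H G disj' that] by (simp add: graph_join_commute)
  have sub: "e \<subseteq> verts K" if "e \<in> edges (graph_complement K)" for e and K :: "'a graph"
    using that by (auto simp: edges_complement vertex_pairs_def)
  have "sombor_coindex (graph_join G H) =
      sum w (edges (graph_complement G)) + sum w (edges (graph_complement H))"
    unfolding sombor_coindex_def complement_edges_join [OF assms] w_def
    by (intro sum.union_disjoint finite_complement_edges G H complement_edges_disjoint disj)
  moreover have "sum w (edges (graph_complement G)) =
      shifted_sombor_coindex G (card (verts H))"
    unfolding shifted_sombor_coindex_def w_def
    by (intro sum.cong refl arg_cong [where f = sqrt]) (metis sub subsetD dG)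
  moreover have "sum w (edges (graph_complement H)) =
      shifted_sombor_coindex H (card (verts G))"
    unfolding shifted_sombor_coindex_def w_def
    by (intro sum.cong refl arg_cong [where f = sqrt]) (metis sub subsetD dH)
  ultimately show ?thesis by simp
qed

section \<open>Bounds by the extreme degrees\<close>

text \<open>Both bounds are the monotonicity of the norm, since \<open>sqrt (x\<^sup>2 + x\<^sup>2) = sqrt 2 * x\<close> for
  \<open>x \<ge> 0\<close>.\<close>

lemma sqrt_sum_squares_pair_bounds:
  fixes f :: "'a \<Rightarrow> real"
  assumes "card e = 2" and "0 \<le> l" and bounds: "\<And>u. u \<in> e \<Longrightarrow> l \<le> f u \<and> f u \<le> h"
  shows "sqrt 2 * l \<le> sqrt (\<Sum>u\<in>e. (f u)\<^sup>2)" and "sqrt (\<Sum>u\<in>e. (f u)\<^sup>2) \<le> sqrt 2 * h"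
proof -
  obtain a b where e: "e = {a, b}" "a \<noteq> b" using assms(1) by (auto simp: card_2_iff)
  have a: "l \<le> f a" "f a \<le> h" and b: "l \<le> f b" "f b \<le> h" using bounds e by auto
  have "0 \<le> h" using a \<open>0 \<le> l\<close> by linarith
  have "2 * l\<^sup>2 \<le> (f a)\<^sup>2 + (f b)\<^sup>2"
    using power_mono [OF a(1) \<open>0 \<le> l\<close>, of 2] power_mono [OF b(1) \<open>0 \<le> l\<close>, of 2] by linarith
  then have "sqrt (2 * l\<^sup>2) \<le> sqrt (\<Sum>u\<in>e. (f u)\<^sup>2)" using e by simp
  then show "sqrt 2 * l \<le> sqrt (\<Sum>u\<in>e. (f u)\<^sup>2)"
    using \<open>0 \<le> l\<close> by (simp add: real_sqrt_mult)
  have "(f a)\<^sup>2 + (f b)\<^sup>2 \<le> 2 * h\<^sup>2"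
    using power_mono [OF a(2), of 2] power_mono [OF b(2), of 2] a b \<open>0 \<le> l\<close> by linarith
  then have "sqrt (\<Sum>u\<in>e. (f u)\<^sup>2) \<le> sqrt (2 * h\<^sup>2)" using e by simp
  then show "sqrt (\<Sum>u\<in>e. (f u)\<^sup>2) \<le> sqrt 2 * h"
    using \<open>0 \<le> h\<close> by (simp add: real_sqrt_mult)
qed

lemma shifted_sombor_coindex_bounds:
  fixes G :: "'a graph" and n :: nat
  defines "mbar \<equiv> real (card (edges (graph_complement G)))"
  assumes G: "finite_simple_graph G"
  shows "sqrt 2 * (mbar * (real (min_degree G) + real n)) \<le> shifted_sombor_coindex G n"
    and "shifted_sombor_coindex G n \<le> sqrt 2 * (mbar * (real (max_degree G) + real n))"
proof -
  have deg: "min_degree G \<le> vdegree G u \<and> vdegree G u \<le> max_degree G" if "u \<in> verts G" for u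
    using G that by (auto simp: finite_simple_graph_def min_degree_def max_degree_def)
  let ?w = "\<lambda>e. sqrt (\<Sum>u \<in> e. (real (vdegree G u + n))\<^sup>2)"
  have w: "sqrt 2 * (real (min_degree G) + real n) \<le> ?w e"
    "?w e \<le> sqrt 2 * (real (max_degree G) + real n)"
    if "e \<in> edges (graph_complement G)" for e
  proof -
    have e: "card e = 2" "e \<subseteq> verts G"
      using that by (auto simp: edges_complement vertex_pairs_def)
    have "real (min_degree G) + real n \<le> real (vdegree G u + n) \<and>
        real (vdegree G u + n) \<le> real (max_degree G) + real n" if "u \<in> e" for u
      using deg [of u] that e by auto
    with e show "sqrt 2 * (real (min_degree G) + real n) \<le> ?w e"
      "?w e \<le> sqrt 2 * (real (max_degree G) + real n)"
      using sqrt_sum_squares_pair_bounds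
        [of e "real (min_degree G) + real n" "\<lambda>u. real (vdegree G u + n)"
          "real (max_degree G) + real n"]
      by simp_all
  qed
  show "sqrt 2 * (mbar * (real (min_degree G) + real n)) \<le> shifted_sombor_coindex G n"
    using sum_bounded_below [of "edges (graph_complement G)" _ ?w, OF w(1)]
    by (simp add: shifted_sombor_coindex_def mbar_def mult_ac)
  show "shifted_sombor_coindex G n \<le> sqrt 2 * (mbar * (real (max_degree G) + real n))"
    using sum_bounded_above [of "edges (graph_complement G)" ?w, OF w(2)]
    by (simp add: shifted_sombor_coindex_def mbar_def mult_ac)
qed

lemma max_degree_eq_min_degree:
  assumes "finite_simple_graph G" and "regular_graph G"
  shows "max_degree G = min_degree G"
proof -
  obtain r where "\<forall>u \<in> verts G. vdegree G u = r"
    using assms(2) by (auto simp: regular_graph_def)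
  moreover have "verts G \<noteq> {}" using assms(1) by (simp add: finite_simple_graph_def)
  ultimately have "vdegree G ` verts G = {r}" by auto
  then show ?thesis by (simp add: max_degree_def min_degree_def)
qed

theorem theorem5p2:
  fixes G1 G2 :: "'a graph"
    and n1 n2 m1 m2 mbar1 mbar2 \<Delta>1 \<Delta>2 \<delta>1 \<delta>2 :: nat
  assumes "finite_simple_graph G1" and "finite_simple_graph G2"
    and "verts G1 \<inter> verts G2 = {}"
    and "n1 = card (verts G1)" and "n2 = card (verts G2)"
    and "m1 = card (edges G1)" and "m2 = card (edges G2)"
    and "\<Delta>1 = max_degree G1" and "\<Delta>2 = max_degree G2"
    and "\<delta>1 = min_degree G1" and "\<delta>2 = min_degree G2"
    and "mbar1 = card (edges (graph_complement G1))"
    and "mbar2 = card (edges (graph_complement G2))"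
  shows "real mbar1 = real (n1 choose 2) - real m1 \<and>
         real mbar2 = real (n2 choose 2) - real m2 \<and>
         sombor_coindex (graph_join G1 G2) \<le>
           sqrt 2 * (real mbar1 * (real \<Delta>1 + real n2) + real mbar2 * (real \<Delta>2 + real n1)) \<and>
         sombor_coindex (graph_join G1 G2) \<ge>
           sqrt 2 * (real mbar1 * (real \<delta>1 + real n2) + real mbar2 * (real \<delta>2 + real n1)) \<and>
         (regular_graph G1 \<and> regular_graph G2 \<longrightarrow>
           sombor_coindex (graph_join G1 G2) =
             sqrt 2 * (real mbar1 * (real \<Delta>1 + real n2) + real mbar2 * (real \<Delta>2 + real n1)) \<and>
           sombor_coindex (graph_join G1 G2) =
             sqrt 2 * (real mbar1 * (real \<delta>1 + real n2) + real mbar2 * (real \<delta>2 + real n1)))"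
proof -
  let ?S = "sombor_coindex (graph_join G1 G2)"
  let ?upper = "sqrt 2 * (real mbar1 * (real \<Delta>1 + real n2) + real mbar2 * (real \<Delta>2 + real n1))"
  let ?lower = "sqrt 2 * (real mbar1 * (real \<delta>1 + real n2) + real mbar2 * (real \<delta>2 + real n1))"
  have S: "?S = shifted_sombor_coindex G1 n2 + shifted_sombor_coindex G2 n1"
    using sombor_coindex_join [OF assms(1-3)] by (simp add: assms(4,5))
  have upper: "?S \<le> ?upper"
    using shifted_sombor_coindex_bounds(2) [OF assms(1), of n2]
      shifted_sombor_coindex_bounds(2) [OF assms(2), of n1]
    unfolding S assms(8-13) distrib_left [of "sqrt 2"] by linarith
  have lower: "?lower \<le> ?S"
    using shifted_sombor_coindex_bounds(1) [OF assms(1), of n2]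
      shifted_sombor_coindex_bounds(1) [OF assms(2), of n1]
    unfolding S assms(8-13) distrib_left [of "sqrt 2"] by linarith
  have "?upper = ?lower" if "regular_graph G1 \<and> regular_graph G2"
    using that by (simp add: assms(1,2,8-11) max_degree_eq_min_degree)
  then have "regular_graph G1 \<and> regular_graph G2 \<longrightarrow> ?S = ?upper \<and> ?S = ?lower"
    using upper lower by linarith
  moreover have "real mbar1 = real (n1 choose 2) - real m1"
    and "real mbar2 = real (n2 choose 2) - real m2"
    by (simp_all add: assms(1,2,4-7,12,13) card_complement_edges)
  ultimately show ?thesis using upper lower by blast
qed

end
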